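(* Let $V$ be a complex Banach space and $C\subset V$ a linearly convex proper complex cone. Then $\delta_C$ is a projective metric on $C$, and for all $x,y\in C\setminus\{0\}$ $$ \delta_C(x,y)=\sup_{f,g\in C'}\log\left|\frac{\langle f,y\rangle\langle g,x\rangle}{\langle f,x\rangle\langle g,y\rangle}\right|. $$
   Context: Let $V'$ be the (continuous) dual of $V$ and $\langle\cdot,\cdot\rangle:V'\times V\to\mathbb{C}$ the canonical duality. A non-empty subset $C\subset V$ is a complex cone if $\mathbb{C}^*C\subset C$, where $\mathbb{C}^*=\mathbb{C}\setminus\{0\}$; it is proper if its closure contains no complex plane (no complex vector subspace of complex dimension 2). A complex cone $C$ is linearly convex if through each point of the complement of $C$ there passes a complex hyperplane (kernel of a nonzero element of $V'$) not intersecting $C$; its dual complement is $C'=\{f\in V': \forall x\in C,\ \langle f,x\rangle\neq 0\}$. For a proper complex cone $C$ and $x,y\in C\setminus\{0\}$, let $E_C(x,y)=\{z\in\mathbb{C}: zx-y\notin C\}$. If $x,y$ are colinear, $\delta_C(x,y)=0$. If $x,y$ are linearly independent, $\delta_C(x,y)=\log(b/a)\in[0,\infty]$, where $b=\sup\{|z|:z\in E_C(x,y)\}\in(0,\infty]$ and $a=\inf\{|z|:z\in E_C(x,y)\}\in[0,\infty)$ (with $\log(b/a)=\infty$ if $b=\infty$ or $a=0$; properness guarantees $E_C(x,y)\ne\emptyset$). "Projective metric" on $C$ means: $\delta_C:(C\setminus\{0\})^2\to[0,\infty]$ is symmetric, satisfies the triangle inequality, satisfies $\delta_C(x,\lambda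 y)=\delta_C(x,y)$ for $\lambda\in\mathbb{C}^*$, and $\delta_C(x,y)=0$ if and only if $x,y$ are colinear. The supremum is taken in $[0,\infty]$, with $\sup\emptyset=0$ (relevant only in the degenerate case $C=V$; otherwise $0\notin C$ and $0\notin C'$). *)

theory Defs
  imports "HOL-Analysis.Analysis"
begin

text \<open>The class \<open>banach\<close> of the library is real; a complex Banach space is a real one whose
  scalar multiplication extends to a complex scalar multiplication with multiplicative norm.\<close>

class complex_banach = banach +
  fixes scaleC :: "complex \<Rightarrow> 'a \<Rightarrow> 'a"  (infixr \<open>*\<^sub>C\<close> 75)
  assumes scaleC_add_right: "c *\<^sub>C (x + y) = c *\<^sub>C x + c *\<^sub>C y"
    and scaleC_add_left: "(c + d) *\<^sub>C x = c *\<^sub>C x + d *\<^sub>C x"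
    and scaleC_scaleC: "c *\<^sub>C (d *\<^sub>C x) = (c * d) *\<^sub>C x"
    and scaleC_of_real: "complex_of_real r *\<^sub>C x = r *\<^sub>R x"
    and norm_scaleC: "norm (c *\<^sub>C x) = cmod c * norm x"

global_interpretation complex_vector:
  vector_space "scaleC :: complex \<Rightarrow> 'a \<Rightarrow> 'a::complex_banach"
proof
  fix c d :: complex and x y :: 'a
  show "c *\<^sub>C (x + y) = c *\<^sub>C x + c *\<^sub>C y" by (rule scaleC_add_right)
  show "(c + d) *\<^sub>C x = c *\<^sub>C x + d *\<^sub>C x" by (rule scaleC_add_left)
  show "c *\<^sub>C d *\<^sub>C x = (c * d) *\<^sub>C x" by (rule scaleC_scaleC)
  show "1 *\<^sub>C x = x" using scaleC_of_real[of 1 x] by simp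
qed

definition cdual :: "('a::complex_banach \<Rightarrow> complex) set" where
  "cdual = {f. Vector_Spaces.linear scaleC (*) f \<and> continuous_on UNIV f}"

definition is_complex_cone :: "'a::complex_banach set \<Rightarrow> bool" where
  "is_complex_cone C \<longleftrightarrow> C \<noteq> {} \<and> (\<forall>c x. c \<noteq> 0 \<longrightarrow> x \<in> C \<longrightarrow> c *\<^sub>C x \<in> C)"

text \<open>\<open>complex_vector.dim\<close> is \<open>0\<close> on infinite-dimensional spaces, so \<open>dim W = 2\<close> does
  single out the complex planes.\<close>

definition proper_cone :: "'a::complex_banach set \<Rightarrow> bool" where
  "proper_cone C \<longleftrightarrow>
    \<not> (\<exists>W. complex_vector.subspace W \<and> complex_vector.dim W = 2 \<and> W \<subseteq> closure C)"

definition complex_hyperplane :: "'a::complex_banach set \<Rightarrow> bool" where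
  "complex_hyperplane H \<longleftrightarrow> (\<exists>f\<in>cdual. f \<noteq> (\<lambda>_. 0) \<and> H = {x. f x = 0})"

definition linearly_convex :: "'a::complex_banach set \<Rightarrow> bool" where
  "linearly_convex C \<longleftrightarrow> (\<forall>p. p \<notin> C \<longrightarrow> (\<exists>H. complex_hyperplane H \<and> p \<in> H \<and> H \<inter> C = {}))"

definition dual_complement :: "'a::complex_banach set \<Rightarrow> ('a \<Rightarrow> complex) set" where
  "dual_complement C = {f \<in> cdual. \<forall>x\<in>C. f x \<noteq> 0}"

definition colinear :: "'a::complex_banach \<Rightarrow> 'a \<Rightarrow> bool" where
  "colinear x y \<longleftrightarrow> (\<exists>a b. (a \<noteq> 0 \<or> b \<noteq> 0) \<and> a *\<^sub>C x + b *\<^sub>C y = 0)"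

definition E_set :: "'a::complex_banach set \<Rightarrow> 'a \<Rightarrow> 'a \<Rightarrow> complex set" where
  "E_set C x y = {z. z *\<^sub>C x - y \<notin> C}"

text \<open>Meaningful for a proper cone \<open>C\<close> and \<open>x, y \<in> C - {0}\<close> only: then \<open>E_set C x y\<close> is
  non-empty for independent \<open>x, y\<close>, so that \<open>0 < b\<close> and \<open>a < \<infinity>\<close>.\<close>

definition cone_dist :: "'a::complex_banach set \<Rightarrow> 'a \<Rightarrow> 'a \<Rightarrow> ereal" where
  "cone_dist C x y =
    (if colinear x y then 0
     else let b = (SUP z\<in>E_set C x y. ereal (cmod z));
              a = (INF z\<in>E_set C x y. ereal (cmod z))
          in if b = \<infinity> \<or> a = 0 then \<infinity>
             else ereal (ln (real_of_ereal b / real_of_ereal a)))"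

definition projective_metric_on ::
    "'a::complex_banach set \<Rightarrow> ('a \<Rightarrow> 'a \<Rightarrow> ereal) \<Rightarrow> bool" where
  "projective_metric_on C d \<longleftrightarrow>
    (\<forall>x\<in>C - {0}. \<forall>y\<in>C - {0}. 0 \<le> d x y) \<and>
    (\<forall>x\<in>C - {0}. \<forall>y\<in>C - {0}. d x y = d y x) \<and>
    (\<forall>x\<in>C - {0}. \<forall>y\<in>C - {0}. \<forall>z\<in>C - {0}. d x z \<le> d x y + d y z) \<and>
    (\<forall>x\<in>C - {0}. \<forall>y\<in>C - {0}. \<forall>c. c \<noteq> 0 \<longrightarrow> d x (c *\<^sub>C y) = d x y) \<and>
    (\<forall>x\<in>C - {0}. \<forall>y\<in>C - {0}. d x y = 0 \<longleftrightarrow> colinear x y)"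

text \<open>The outer join with \<open>0\<close> makes this the supremum in \<open>[0, \<infinity>]\<close>: in \<^typ>\<open>ereal\<close> the
  supremum of the empty set is \<open>-\<infinity>\<close>. It matters only if \<open>dual_complement C\<close> is empty, since
  the pair \<open>f = g\<close> contributes \<open>0\<close> otherwise.\<close>

definition dual_sup :: "'a::complex_banach set \<Rightarrow> 'a \<Rightarrow> 'a \<Rightarrow> ereal" where
  "dual_sup C x y =
    sup 0 (SUP (f, g) \<in> dual_complement C \<times> dual_complement C.
             ereal (ln (cmod ((f y * g x) / (f x * g y)))))"

end

theory Submission
  imports Defs
begin

text \<open>Every quantity in the theorem lives on the complex line \<open>z \<mapsto> z *\<^sub>C x - y\<close>. A point of this
  line misses a linearly convex cone \<open>C\<close> exactly when some \<open>f\<close> in the dual complement vanishes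
  there, that is, when \<open>z = f y / f x\<close>. So the set \<open>E_set C x y\<close> of parameters of missing points is
  the set of all quotients \<open>f y / f x\<close> (lemma \<open>E_set_eq_dual_quotients\<close>), and the logarithm of the
  ratio of the supremum to the infimum of the moduli in it is the supremum of the logarithms of
  ratios of two such moduli (lemma \<open>ln_SUP_div_INF_eq_SUP_ln_div\<close>). This is the duality formula.

  Symmetry, scale invariance and the triangle inequality can be read off the right-hand side of
  the duality formula, where the last one holds pair by pair: the cross ratio of \<open>f, g\<close> at \<open>x, y\<close>
  is \<open>(f y * g x) / (f x * g y)\<close>, and the one at \<open>x, z\<close> is the product of those at \<open>x, y\<close> and at
  \<open>y, z\<close>.

  Properness enters only through lemma \<open>interior_E_set_nonempty\<close>: if \<open>E_set C x y\<close> had empty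
  interior, the line would meet \<open>C\<close> in a dense set and the closure of \<open>C\<close> would contain the whole
  plane spanned by \<open>x\<close> and \<open>y\<close>. It follows that \<open>E_set C x y\<close> is non-empty for independent \<open>x, y\<close>,
  and that it is not contained in a circle around \<open>0\<close>, which is what distance \<open>0\<close> would force.\<close>

section \<open>Proper cones and complex lines\<close>

lemma continuous_on_scaleC_left: "continuous_on S (\<lambda>z. z *\<^sub>C (x :: 'a::complex_banach))"
proof -
  have "bounded_linear (\<lambda>z. z *\<^sub>C x)"
  proof (rule bounded_linear_intro[where K = "norm x"])
    fix r :: real and z :: complex
    show "(r *\<^sub>R z) *\<^sub>C x = r *\<^sub>R (z *\<^sub>C x)"
      by (simp add: scaleR_conv_of_real scaleC_scaleC flip: scaleC_of_real)
  qed (simp_all add: scaleC_add_left norm_scaleC)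
  then show ?thesis
    by (rule bounded_linear.continuous_on) (rule continuous_on_id)
qed

lemma continuous_on_scaleC_right: "continuous_on S (\<lambda>v :: 'a::complex_banach. c *\<^sub>C v)"
proof -
  have "bounded_linear (\<lambda>v :: 'a. c *\<^sub>C v)"
  proof (rule bounded_linear_intro[where K = "cmod c"])
    fix r :: real and v :: 'a
    show "c *\<^sub>C (r *\<^sub>R v) = r *\<^sub>R (c *\<^sub>C v)"
      by (simp add: scaleC_scaleC mult.commute flip: scaleC_of_real)
  qed (simp_all add: scaleC_add_right norm_scaleC mult.commute)
  then show ?thesis
    by (rule bounded_linear.continuous_on) (rule continuous_on_id)
qed

lemma closure_complex_cone:
  assumes "is_complex_cone C" "v \<in> closure C"
  shows "c *\<^sub>C v \<in> closure C"
proof (cases "c = 0")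
  case False
  have "(\<lambda>v. c *\<^sub>C v) ` closure C \<subseteq> closure C"
  proof (rule image_closure_subset)
    show "(\<lambda>v. c *\<^sub>C v) ` C \<subseteq> closure C"
      using assms(1) False closure_subset by (fastforce simp: is_complex_cone_def)
  qed (auto intro: continuous_on_scaleC_right)
  then show ?thesis using assms(2) by blast
next
  case True
  \<comment> \<open>The origin is the limit of the small multiples of any point of the cone.\<close>
  obtain p where "p \<in> C" using assms(1) by (auto simp: is_complex_cone_def)
  have "(\<lambda>z. z *\<^sub>C p) ` closure (- {0}) \<subseteq> closure C"
  proof (rule image_closure_subset)
    show "(\<lambda>z. z *\<^sub>C p) ` (- {0}) \<subseteq> closure C"
      using assms(1) \<open>p \<in> C\<close> closure_subset by (fastforce simp: is_complex_cone_def)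
  qed (auto intro: continuous_on_scaleC_left)
  moreover have "0 \<in> closure (- {0 :: complex})"
    by (simp add: closure_complement)
  ultimately have "0 *\<^sub>C p \<in> closure C" by blast
  then show ?thesis using True by simp
qed

lemma dim_span_pair_eq_2:
  assumes "\<not> colinear x y"
  shows "complex_vector.dim (complex_vector.span {x, y}) = 2"
proof -
  have "y \<noteq> 0"
  proof
    assume "y = 0"
    then have "0 *\<^sub>C x + 1 *\<^sub>C y = 0" by simp
    then show False using assms unfolding colinear_def by (metis zero_neq_one)
  qed
  moreover have not_multiple: "x \<noteq> k *\<^sub>C y" for k
  proof
    assume "x = k *\<^sub>C y"
    then have "1 *\<^sub>C x + (- k) *\<^sub>C y = 0" by simp
    then show False using assms unfolding colinear_def by (metis zero_neq_one)
  qed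
  moreover have "x \<noteq> y" using not_multiple[of 1] by simp
  ultimately have "complex_vector.independent {x, y}"
    by (auto simp: complex_vector.independent_insert complex_vector.span_singleton)
  then show ?thesis
    using \<open>x \<noteq> y\<close> complex_vector.dim_span_eq_card_independent[of "{x, y}"]
    by (simp del: complex_vector.dim_span)
qed

text \<open>The line \<open>z \<mapsto> z *\<^sub>C x - y\<close> avoids the origin of the plane of \<open>x\<close> and \<open>y\<close>, so the multiples
  of its points fill that plane up to the direction of \<open>x\<close>. If \<open>C\<close> is dense on the line, the
  closure of \<open>C\<close> thus contains the plane.\<close>

lemma interior_E_set_nonempty:
  assumes cone: "is_complex_cone C" and "proper_cone C" and "x \<in> C" and "\<not> colinear x y"
  shows "interior (E_set C x y) \<noteq> {}"
proof
  assume "interior (E_set C x y) = {}"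
  then have dense: "closure (- E_set C x y) = UNIV"
    by (simp add: closure_complement)
  have "(\<lambda>z. z *\<^sub>C x - y) ` closure (- E_set C x y) \<subseteq> closure C"
  proof (rule image_closure_subset)
    show "(\<lambda>z. z *\<^sub>C x - y) ` (- E_set C x y) \<subseteq> closure C"
      using closure_subset by (fastforce simp: E_set_def)
  qed (auto intro!: continuous_intros continuous_on_scaleC_left)
  then have line: "z *\<^sub>C x - y \<in> closure C" for z
    using dense by blast
  have plane: "a *\<^sub>C x + b *\<^sub>C y \<in> closure C" for a b
  proof (cases "b = 0")
    case True
    have "x \<in> closure C" using assms(3) closure_subset by blast
    then show ?thesis using closure_complex_cone[OF cone] True by simp
  next
    case False
    then have "a *\<^sub>C x + b *\<^sub>C y = (- b) *\<^sub>C ((- a / b) *\<^sub>C x - y)"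
      by (simp add: complex_vector.scale_right_diff_distrib)
    then show ?thesis using closure_complex_cone[OF cone line] by metis
  qed
  have "complex_vector.span {x, y} \<subseteq> closure C"
  proof
    fix v assume "v \<in> complex_vector.span {x, y}"
    then obtain a b where "v - a *\<^sub>C x = b *\<^sub>C y"
      by (auto simp: complex_vector.span_breakdown_eq complex_vector.span_singleton)
    then have "v = a *\<^sub>C x + b *\<^sub>C y" by (simp add: algebra_simps)
    then show "v \<in> closure C" using plane by simp
  qed
  then show False
    using assms(2) dim_span_pair_eq_2[OF assms(4)] complex_vector.subspace_span
    unfolding proper_cone_def by blast
qed

section \<open>Missing points as quotients of functionals\<close>

lemma cdual_diff: "f \<in> cdual \<Longrightarrow> f (u - v) = f u - f v"
  and cdual_scaleC: "f \<in> cdual \<Longrightarrow> f (c *\<^sub>C v) = c * f v"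
  by (auto simp: cdual_def Vector_Spaces.linear_iff_module_hom module_hom.diff module_hom.scale)

text \<open>A hyperplane that misses \<open>C\<close> is the kernel of an element of the dual complement, and on
  the line \<open>z \<mapsto> z *\<^sub>C x - y\<close> such an \<open>f\<close> has the single zero \<open>f y / f x\<close>.\<close>

lemma E_set_eq_dual_quotients:
  assumes "linearly_convex C" "x \<in> C"
  shows "E_set C x y = (\<lambda>f. f y / f x) ` dual_complement C"
proof (intro equalityI subsetI)
  fix z assume "z \<in> E_set C x y"
  then obtain H where "complex_hyperplane H" "z *\<^sub>C x - y \<in> H" "H \<inter> C = {}"
    using assms(1) by (auto simp: E_set_def linearly_convex_def)
  then obtain f where f: "f \<in> cdual" "f (z *\<^sub>C x - y) = 0" "\<forall>v\<in>C. f v \<noteq> 0"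
    by (auto simp: complex_hyperplane_def)
  then have "f \<in> dual_complement C" by (simp add: dual_complement_def)
  moreover have "z = f y / f x"
    using f assms(2) by (simp add: cdual_diff cdual_scaleC field_simps)
  ultimately show "z \<in> (\<lambda>f. f y / f x) ` dual_complement C" by blast
next
  fix z assume "z \<in> (\<lambda>f. f y / f x) ` dual_complement C"
  then obtain f where f: "f \<in> cdual" "\<forall>v\<in>C. f v \<noteq> 0" "z = f y / f x"
    by (auto simp: dual_complement_def)
  then have "f (z *\<^sub>C x - y) = 0"
    using assms(2) by (simp add: cdual_diff cdual_scaleC)
  then show "z \<in> E_set C x y" using f(2) by (auto simp: E_set_def)
qed

section \<open>Suprema of logarithms of ratios\<close>

text \<open>For the lower bound, \<open>e\<^sup>u * a < b\<close> yields \<open>s\<close> with \<open>e\<^sup>u * a < s\<close> from the supremum and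
  then \<open>t\<close> with \<open>e\<^sup>u * t < s\<close> from the infimum. The inequality \<open>e\<^sup>u * a < b\<close> holds for all \<open>u\<close> in
  the two infinite cases and for \<open>u < ln (b / a)\<close> in the finite one.\<close>

lemma ln_SUP_div_INF_eq_SUP_ln_div:
  fixes S :: "real set"
  assumes pos: "\<And>s. s \<in> S \<Longrightarrow> 0 < s" and "S \<noteq> {}"
  defines "b \<equiv> SUP s\<in>S. ereal s" and "a \<equiv> INF s\<in>S. ereal s"
  shows "(if b = \<infinity> \<or> a = 0 then \<infinity> else ereal (ln (real_of_ereal b / real_of_ereal a))) =
    (SUP (s, t)\<in>S \<times> S. ereal (ln (s / t)))" (is "?L = ?R")
proof -
  obtain s0 where s0: "s0 \<in> S" using assms(2) by blast
  have le_b: "ereal s \<le> b" and a_le: "a \<le> ereal s" if "s \<in> S" for s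
    using that unfolding a_def b_def by (auto intro: SUP_upper INF_lower)
  have "0 < b" using le_b[OF s0] pos[OF s0] by (metis ereal_less(2) less_le_trans)
  have "0 \<le> a" unfolding a_def using pos by (intro INF_greatest) (simp add: less_imp_le)
  have "a < \<infinity>" using a_le[OF s0] by auto
  then obtain \<alpha> where \<alpha>: "a = ereal \<alpha>" using \<open>0 \<le> a\<close> by (cases a) auto
  have lower: "ereal u < ?R" if "ereal (exp u * \<alpha>) < b" for u
  proof -
    obtain s where s: "s \<in> S" "exp u * \<alpha> < s"
      using \<open>ereal (exp u * \<alpha>) < b\<close> unfolding b_def less_SUP_iff by auto
    then have "a < ereal (s / exp u)" unfolding \<alpha> by (simp add: field_simps)
    then obtain t where t: "t \<in> S" "t < s / exp u"
      unfolding a_def INF_less_iff by auto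
    have "exp u < s / t" using t pos[OF t(1)] by (simp add: field_simps)
    then have "u < ln (s / t)"
      using pos[OF s(1)] pos[OF t(1)] by (metis divide_pos_pos exp_less_cancel_iff exp_ln)
    moreover have "ereal (ln (s / t)) \<le> ?R"
      using s(1) t(1) by (intro SUP_upper2[where i = "(s, t)"]) auto
    ultimately show ?thesis by (metis ereal_less_eq(3) less_ereal.simps(1) less_le_trans)
  qed
  show ?thesis
  proof (cases "b = \<infinity> \<or> a = 0")
    case True
    then have "ereal u < ?R" for u
      using \<open>0 < b\<close> \<alpha> by (intro lower) (auto simp flip: zero_ereal_def)
    then have "?R = \<infinity>" by (intro ereal_top less_imp_le)
    then show ?thesis using True by simp
  next
    case False
    then obtain \<beta> where \<beta>: "b = ereal \<beta>" using \<open>0 < b\<close> by (cases b) auto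
    have "0 < \<alpha>" "0 < \<beta>" using False \<open>0 \<le> a\<close> \<open>0 < b\<close> \<alpha> \<beta> by auto
    have "?R \<le> ereal (ln (\<beta> / \<alpha>))"
    proof (rule SUP_least)
      fix p assume "p \<in> S \<times> S"
      then obtain s t where p: "p = (s, t)" "s \<in> S" "t \<in> S" by auto
      have "s / t \<le> \<beta> / \<alpha>"
        using le_b[OF p(2)] a_le[OF p(3)] pos[OF p(2)] \<open>0 < \<alpha>\<close> \<open>0 < \<beta>\<close>
        by (intro frac_le) (auto simp: \<alpha> \<beta>)
      then show "(case p of (s, t) \<Rightarrow> ereal (ln (s / t))) \<le> ereal (ln (\<beta> / \<alpha>))"
        using pos[OF p(2)] pos[OF p(3)] p(1) by (simp add: ln_mono)
    qed
    moreover have "ereal (ln (\<beta> / \<alpha>)) \<le> ?R"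
    proof (rule dense_le)
      fix w assume w: "w < ereal (ln (\<beta> / \<alpha>))"
      show "w \<le> ?R"
      proof (cases w)
        case (real u)
        then have "exp u < \<beta> / \<alpha>"
          using w \<open>0 < \<alpha>\<close> \<open>0 < \<beta>\<close>
          by (metis divide_pos_pos exp_less_cancel_iff exp_ln less_ereal.simps(1))
        then have "ereal (exp u * \<alpha>) < b" using \<open>0 < \<alpha>\<close> by (simp add: \<beta> field_simps)
        then show ?thesis using lower real by (simp add: less_imp_le)
      qed (use w in auto)
    qed
    ultimately show ?thesis using False by (simp add: \<alpha> \<beta>)
  qed
qed

section \<open>Cross ratios\<close>

lemma dual_complement_nonzero: "f \<in> dual_complement C \<Longrightarrow> x \<in> C \<Longrightarrow> f x \<noteq> 0"
  by (simp add: dual_complement_def)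

lemma cross_ratio_le_dual_sup:
  assumes "f \<in> dual_complement C" "g \<in> dual_complement C"
  shows "ereal (ln (cmod ((f y * g x) / (f x * g y)))) \<le> dual_sup C x y"
  unfolding dual_sup_def using assms
  by (intro le_supI2 SUP_upper2[where i = "(f, g)"]) auto

lemma dual_sup_leI:
  assumes "0 \<le> r"
    and "\<And>f g. f \<in> dual_complement C \<Longrightarrow> g \<in> dual_complement C \<Longrightarrow>
      ereal (ln (cmod ((f y * g x) / (f x * g y)))) \<le> r"
  shows "dual_sup C x y \<le> r"
  unfolding dual_sup_def using assms by (auto intro!: le_supI SUP_least)

lemma dual_sup_nonneg: "0 \<le> dual_sup C x y"
  by (simp add: dual_sup_def)

text \<open>Interchanging \<open>x\<close> and \<open>y\<close> has the same effect on the cross ratio as interchanging \<open>f\<close> and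
  \<open>g\<close>.\<close>

lemma dual_sup_commute: "dual_sup C x y = dual_sup C y x"
proof -
  have "dual_sup C x y \<le> dual_sup C y x" for x y
  proof (rule dual_sup_leI[OF dual_sup_nonneg])
    fix f g assume "f \<in> dual_complement C" "g \<in> dual_complement C"
    then show "ereal (ln (cmod ((f y * g x) / (f x * g y)))) \<le> dual_sup C y x"
      using cross_ratio_le_dual_sup[of g C f x y] by (simp add: mult.commute)
  qed
  then show ?thesis by (simp add: antisym)
qed

lemma dual_sup_triangle:
  assumes "x \<in> C" "y \<in> C" "z \<in> C"
  shows "dual_sup C x z \<le> dual_sup C x y + dual_sup C y z"
proof (rule dual_sup_leI)
  fix f g assume fg: "f \<in> dual_complement C" "g \<in> dual_complement C"
  let ?q = "\<lambda>x y. cmod ((f y * g x) / (f x * g y))"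
  have nz: "f v \<noteq> 0" "g v \<noteq> 0" if "v \<in> C" for v
    using fg that by (auto dest: dual_complement_nonzero)
  have "?q x z = ?q x y * ?q y z"
    using nz assms by (simp add: norm_mult norm_divide field_simps)
  moreover have "0 < ?q x y" "0 < ?q y z" using nz assms by simp_all
  ultimately have "ereal (ln (?q x z)) = ereal (ln (?q x y)) + ereal (ln (?q y z))"
    by (simp only: ln_mult_pos plus_ereal.simps)
  also have "\<dots> \<le> dual_sup C x y + dual_sup C y z"
    by (intro add_mono cross_ratio_le_dual_sup fg)
  finally show "ereal (ln (?q x z)) \<le> dual_sup C x y + dual_sup C y z" .
qed (simp add: dual_sup_nonneg)

lemma dual_sup_scaleC:
  assumes "c \<noteq> 0"
  shows "dual_sup C x (c *\<^sub>C y) = dual_sup C x y"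
proof -
  have "(f (c *\<^sub>C y) * g x) / (f x * g (c *\<^sub>C y)) = (f y * g x) / (f x * g y)"
    if "f \<in> dual_complement C" "g \<in> dual_complement C" for f g
    using that assms by (simp add: dual_complement_def cdual_scaleC)
  then show ?thesis
    unfolding dual_sup_def by (intro arg_cong[where f = "sup 0"] SUP_cong) auto
qed

lemma colinear_imp_multiple:
  assumes "colinear x y" "x \<noteq> 0" "y \<noteq> 0"
  obtains c where "y = c *\<^sub>C x"
proof -
  obtain a b where ab: "a \<noteq> 0 \<or> b \<noteq> 0" "a *\<^sub>C x + b *\<^sub>C y = 0"
    using assms(1) by (auto simp: colinear_def)
  have "b \<noteq> 0" using ab assms(2) by auto
  have "b *\<^sub>C y = (- a) *\<^sub>C x"
    using ab(2) by (simp add: eq_neg_iff_add_eq_0 add.commute)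
  then have "(1 / b) *\<^sub>C b *\<^sub>C y = (1 / b) *\<^sub>C (- a) *\<^sub>C x" by simp
  then have "y = (- a / b) *\<^sub>C x" using \<open>b \<noteq> 0\<close> by simp
  then show thesis by (rule that)
qed

lemma dual_sup_colinear:
  assumes "colinear x y" "x \<noteq> 0" "y \<noteq> 0"
  shows "dual_sup C x y = 0"
proof -
  obtain c where y: "y = c *\<^sub>C x" using assms by (rule colinear_imp_multiple)
  have "dual_sup C x y \<le> 0"
  proof (rule dual_sup_leI)
    fix f g assume "f \<in> dual_complement C" "g \<in> dual_complement C"
    \<comment> \<open>The quotient is \<open>0\<close> if \<open>c = 0\<close>, and \<open>ln 0 = 0\<close> makes this harmless.\<close>
    then have "(f y * g x) / (f x * g y) \<in> {0, 1}"
      by (auto simp: y dual_complement_def cdual_scaleC)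
    then show "ereal (ln (cmod ((f y * g x) / (f x * g y)))) \<le> 0"
      by auto
  qed simp
  then show ?thesis using dual_sup_nonneg by (rule antisym)
qed

section \<open>Duality and definiteness\<close>

lemma cone_dist_eq_dual_sup:
  assumes "is_complex_cone C" "proper_cone C" "linearly_convex C"
    and x: "x \<in> C - {0}" and y: "y \<in> C - {0}"
  shows "cone_dist C x y = dual_sup C x y"
proof (cases "colinear x y")
  case True
  then show ?thesis using dual_sup_colinear x y by (auto simp: cone_dist_def)
next
  case False
  let ?D = "dual_complement C"
  define S where "S = (\<lambda>f. cmod (f y / f x)) ` ?D"
  have E: "E_set C x y = (\<lambda>f. f y / f x) ` ?D"
    using assms by (intro E_set_eq_dual_quotients) auto
  have pos: "0 < s" if "s \<in> S" for s
    using that x y dual_complement_nonzero by (fastforce simp: S_def)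
  have D_nonempty: "?D \<noteq> {}"
    using interior_E_set_nonempty[OF assms(1,2) _ False] x E by auto
  then have "S \<noteq> {}" by (simp add: S_def)
  have "cone_dist C x y = (SUP (s, t)\<in>S \<times> S. ereal (ln (s / t)))"
  proof -
    have "(SUP z\<in>E_set C x y. ereal (cmod z)) = (SUP s\<in>S. ereal s)"
      and "(INF z\<in>E_set C x y. ereal (cmod z)) = (INF s\<in>S. ereal s)"
      by (simp_all only: E S_def image_image)
    then show ?thesis
      using False ln_SUP_div_INF_eq_SUP_ln_div[OF pos \<open>S \<noteq> {}\<close>]
      by (simp only: cone_dist_def Let_def if_False)
  qed
  also have "S \<times> S = (\<lambda>(f, g). (cmod (f y / f x), cmod (g y / g x))) ` (?D \<times> ?D)"
    by (auto simp: S_def)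
  also have "(SUP (s, t)\<in>\<dots>. ereal (ln (s / t))) =
      (SUP (f, g)\<in>?D \<times> ?D. ereal (ln (cmod ((f y * g x) / (f x * g y)))))"
    unfolding image_image
    by (intro SUP_cong) (auto simp: norm_mult norm_divide)
  also have "\<dots> = dual_sup C x y"
  proof -
    obtain f where f: "f \<in> ?D" using D_nonempty by blast
    have "(f y * f x) / (f x * f y) = 1"
      using dual_complement_nonzero[OF f] x y by simp
    then have "0 \<le> (SUP (f, g)\<in>?D \<times> ?D. ereal (ln (cmod ((f y * g x) / (f x * g y)))))"
      using f by (intro SUP_upper2[where i = "(f, f)"]) auto
    then show ?thesis by (simp add: dual_sup_def sup_absorb2)
  qed
  finally show ?thesis .
qed

text \<open>If all cross ratios are at most \<open>1\<close>, all quotients \<open>f y / f x\<close> have the same modulus, and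
  \<open>E_set C x y\<close> lies on a circle, which has empty interior.\<close>

lemma dual_sup_eq_0_imp_colinear:
  assumes "is_complex_cone C" "proper_cone C" "linearly_convex C"
    and "x \<in> C" "y \<in> C" and zero: "dual_sup C x y = 0"
  shows "colinear x y"
proof (rule ccontr)
  let ?D = "dual_complement C"
  assume "\<not> colinear x y"
  then have interior: "interior (E_set C x y) \<noteq> {}"
    using assms by (intro interior_E_set_nonempty)
  have E: "E_set C x y = (\<lambda>f. f y / f x) ` ?D"
    using assms by (intro E_set_eq_dual_quotients)
  then obtain g where g: "g \<in> ?D" using interior by fastforce
  have le: "cmod (f y / f x) \<le> cmod (g y / g x)" if "f \<in> ?D" "g \<in> ?D" for f g
  proof -
    have nz: "f x \<noteq> 0" "f y \<noteq> 0" "g x \<noteq> 0" "g y \<noteq> 0"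
      using that assms by (auto dest: dual_complement_nonzero)
    have "ln (cmod ((f y * g x) / (f x * g y))) \<le> 0"
      using cross_ratio_le_dual_sup[OF that, of y x] zero by simp
    then have "cmod ((f y * g x) / (f x * g y)) \<le> 1"
      using nz by (subst (asm) ln_le_zero_iff) auto
    moreover have "cmod ((f y * g x) / (f x * g y)) = cmod (f y / f x) / cmod (g y / g x)"
      by (simp add: norm_mult norm_divide)
    moreover have "0 < cmod (g y / g x)" using nz by simp
    ultimately show ?thesis by (simp only: pos_divide_le_eq mult_1)
  qed
  have "cmod (f y / f x) = cmod (g y / g x)" if "f \<in> ?D" for f
    using le[OF that g] le[OF g that] by (rule antisym)
  then have "E_set C x y \<subseteq> sphere 0 (cmod (g y / g x))"
    unfolding E by auto
  then have "interior (E_set C x y) \<subseteq> interior (sphere 0 (cmod (g y / g x)))"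
    by (rule interior_mono)
  moreover have "interior (sphere (0::complex) r) = {}" for r
    using open_not_negligible[OF open_interior]
      negligible_subset[OF negligible_sphere interior_subset] by blast
  ultimately show False using interior by blast
qed

theorem lemma2p1:
  fixes C :: "'a::complex_banach set"
  assumes "is_complex_cone C"
    and "proper_cone C"
    and "linearly_convex C"
  shows "projective_metric_on C (cone_dist C) \<and>
    (\<forall>x\<in>C - {0}. \<forall>y\<in>C - {0}. cone_dist C x y = dual_sup C x y)"
proof -
  have duality: "cone_dist C x y = dual_sup C x y" if "x \<in> C - {0}" "y \<in> C - {0}" for x y
    using assms that by (rule cone_dist_eq_dual_sup)
  have scaled: "c *\<^sub>C y \<in> C - {0}" if "y \<in> C - {0}" "c \<noteq> 0" for c y
    using assms(1) that by (auto simp: is_complex_cone_def)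
  have "projective_metric_on C (cone_dist C)"
    unfolding projective_metric_on_def
  proof (intro conjI ballI allI impI)
    fix x y assume x: "x \<in> C - {0}" and y: "y \<in> C - {0}"
    note xy = duality[OF x y]
    show "0 \<le> cone_dist C x y" by (simp add: xy dual_sup_nonneg)
    show "cone_dist C x y = cone_dist C y x"
      using dual_sup_commute by (simp add: xy duality[OF y x])
    show "cone_dist C x z \<le> cone_dist C x y + cone_dist C y z" if z: "z \<in> C - {0}" for z
      using x y z dual_sup_triangle[of x C y z]
      by (simp add: xy duality[OF x z] duality[OF y z])
    show "cone_dist C x (c *\<^sub>C y) = cone_dist C x y" if "c \<noteq> 0" for c
      using dual_sup_scaleC[OF that] by (simp add: xy duality[OF x scaled[OF y that]])
    show "cone_dist C x y = 0 \<longleftrightarrow> colinear x y"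
    proof
      assume "cone_dist C x y = 0"
      then show "colinear x y"
        using dual_sup_eq_0_imp_colinear[OF assms] x y xy by auto
    qed (simp add: cone_dist_def)
  qed
  then show ?thesis using duality by blast
qed

end
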